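(* Let $N(n)$ denote the smallest number of rows $k$ for which a $3$-covering array with $k$ rows and $n$ columns over the alphabet $\{0,1,2\}$ exists. Then, as $n\to\infty$, $$N(n)\le 32.03\,\lg(n)\,(1+o(1)).$$
   Context: For integers $q\ge 2$ and $t\ge 1$, a $t$-covering array with entries from the alphabet $\mathcal{Q}=\{0,1,\ldots,q-1\}$ is a $k\times n$ array ($k$ rows, $n$ columns) with entries in $\mathcal{Q}$ such that for every choice of $t$ distinct columns, each of the $q^t$ words of length $t$ over $\mathcal{Q}$ appears at least once among the rows restricted to the selected columns. Here $\lg=\log_2$. *)

theory Defs
  imports Complex_Main "HOL-Library.FuncSet" "HOL-Library.Landau_Symbols"
begin

text \<open>
  A \<open>k \<times> n\<close> array over \<open>{0, \<dots>, q - 1}\<close> is a function \<open>A\<close> whose value \<open>A r j\<close> is the entry in row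
  \<open>r < k\<close> and column \<open>j < n\<close>; values outside this range are irrelevant. The \<open>t\<close> distinct columns
  are listed by an injection \<open>c\<close>; running over all orders of the same columns is harmless, since
  all words are required.
\<close>

definition covering_array :: "nat \<Rightarrow> nat \<Rightarrow> nat \<Rightarrow> nat \<Rightarrow> (nat \<Rightarrow> nat \<Rightarrow> nat) \<Rightarrow> bool" where
  "covering_array t q k n A \<longleftrightarrow>
     (\<forall>r<k. \<forall>j<n. A r j < q) \<and>
     (\<forall>c \<in> {..<t} \<rightarrow> {..<n}. inj_on c {..<t} \<longrightarrow>
        (\<forall>w \<in> {..<t} \<rightarrow> {..<q}. \<exists>r<k. \<forall>i<t. A r (c i) = w i))"

definition covering_array_number :: "nat \<Rightarrow> nat \<Rightarrow> nat \<Rightarrow> nat" where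
  "covering_array_number t q n = (LEAST k. \<exists>A. covering_array t q k n A)"

text \<open>The minimum is taken over a nonempty set: use all \<open>q ^ n\<close> words as rows.\<close>

lemma ex_covering_array:
  assumes "q > 0"
  shows "\<exists>k A. covering_array t q k n A"
proof -
  let ?W = "{..<n} \<rightarrow>\<^sub>E {..<q}"
  obtain A where A: "bij_betw A {0..<card ?W} ?W"
    using ex_bij_betw_nat_finite[of ?W] by (auto intro: finite_PiE)
  have "\<exists>r<card ?W. \<forall>i<t. A r (c i) = w i"
    if c: "c \<in> {..<t} \<rightarrow> {..<n}" "inj_on c {..<t}" and w: "w \<in> {..<t} \<rightarrow> {..<q}" for c w
  proof -
    define f where "f = (\<lambda>j\<in>{..<n}. if j \<in> c ` {..<t} then w (the_inv_into {..<t} c j) else 0)"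
    have fc: "f (c i) = w i" if "i < t" for i
    proof -
      have "c i < n" using c(1) that by (auto simp: Pi_iff)
      then show ?thesis using that c(2) by (simp add: f_def the_inv_into_f_f)
    qed
    have "f j < q" if "j < n" for j
    proof (cases "j \<in> c ` {..<t}")
      case True
      then obtain i where "i < t" "j = c i" by blast
      then show ?thesis using fc[of i] w by (simp add: Pi_iff)
    next
      case False
      then show ?thesis using that assms by (simp add: f_def)
    qed
    then have "f \<in> ?W" by (simp add: PiE_iff f_def)
    then have "f \<in> A ` {0..<card ?W}" using bij_betw_imp_surj_on[OF A] by simp
    then obtain r where r: "r < card ?W" "f = A r" by (elim imageE) simp
    have "\<forall>i<t. A r (c i) = w i" using fc r(2) by simp
    with r(1) show ?thesis by (intro exI conjI)
  qed
  moreover have "A r j < q" if "r < card ?W" "j < n" for r j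
  proof -
    have "A r \<in> ?W" using bij_betwE[OF A] that(1) by simp
    then show ?thesis using that(2) by (simp add: PiE_iff)
  qed
  ultimately have "covering_array t q (card ?W) n A"
    unfolding covering_array_def by blast
  then show ?thesis by blast
qed

end

theory Submission
  imports Defs
begin

text \<open>
  Concatenate random codewords of the tetracode, the ternary \<open>[4, 2, 3]\<close> code, and let all six
  permutations of the alphabet act on the result; three constant rows take care of the constant
  words. For every pattern \<open>aab\<close>, \<open>aba\<close>, \<open>baa\<close>, \<open>abc\<close>, exactly 225 of the 729 triples of tetracode
  words show this pattern in none of the four positions. As the positions of a block are negatively
  correlated, this beats independent entries: a block costs 24 rows and multiplies the probability
  that a given word is missed in given columns by \<open>25/81 < 2 powr (-3/2)\<close>. By the deletion method
  \<open>(4/3) lg n + O(1)\<close> blocks suffice, that is, \<open>32 lg n + O(1)\<close> rows.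
\<close>

section \<open>Concatenation with a random outer code\<close>

text \<open>Restricted to \<open>t\<close> distinct points, a uniformly random function is uniform:
  every \<open>x\<close> in \<open>M\<close> has the same number of extensions, with one free value
  for each remaining point.\<close>

lemma card_PiE_restrict_comp:
  assumes "finite I" "inj_on c {..<t}" "c ` {..<t} \<subseteq> I" and M: "M \<subseteq> {..<t} \<rightarrow>\<^sub>E S" and "finite S"
  shows "card {g \<in> I \<rightarrow>\<^sub>E S. (\<lambda>i\<in>{..<t}. g (c i)) \<in> M} = card M * card S ^ (card I - t)"
proof -
  define E where "E x = {g \<in> I \<rightarrow>\<^sub>E S. (\<lambda>i\<in>{..<t}. g (c i)) = x}" for x
  have E: "card (E x) = card S ^ (card I - t)" if "x \<in> M" for x
  proof -
    have x: "x \<in> {..<t} \<rightarrow>\<^sub>E S" using that M by blast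
    let ?P = "\<lambda>k. if k \<in> c ` {..<t} then {x (the_inv_into {..<t} c k)} else S"
    have "E x = Pi\<^sub>E I ?P"
    proof (intro set_eqI iffI)
      fix g assume "g \<in> E x"
      then have g: "g \<in> I \<rightarrow>\<^sub>E S" "\<And>i. i < t \<Longrightarrow> g (c i) = x i"
        unfolding E_def by auto
      then show "g \<in> Pi\<^sub>E I ?P"
        using assms(2) by (auto simp: PiE_iff the_inv_into_f_f)
    next
      fix g assume g: "g \<in> Pi\<^sub>E I ?P"
      have gx: "g (c i) = x i" if "i < t" for i
      proof -
        have "c i \<in> I" "c i \<in> c ` {..<t}" using that assms(3) by auto
        moreover have "the_inv_into {..<t} c (c i) = i"
          using that by (intro the_inv_into_f_f[OF assms(2)]) simp
        ultimately show ?thesis using PiE_mem[OF g, of "c i"] by simp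
      qed
      have "g k \<in> S" if "k \<in> I" for k
      proof (cases "k \<in> c ` {..<t}")
        case True
        then show ?thesis using gx x by auto
      next
        case False
        have "g k \<in> ?P k" using g that by (rule PiE_mem)
        then show ?thesis using False by simp
      qed
      moreover have "(\<lambda>i\<in>{..<t}. g (c i)) = x"
        using gx x by (auto simp: fun_eq_iff PiE_iff extensional_def)
      ultimately show "g \<in> E x" using g by (auto simp: E_def PiE_iff)
    qed
    then have "card (E x) = (\<Prod>k\<in>I. card (?P k))"
      using assms(1) by (simp add: card_PiE)
    also have "\<dots> = (\<Prod>k\<in>I - c ` {..<t}. card (?P k))"
      using assms(1) by (intro prod.mono_neutral_right) auto
    also have "\<dots> = (\<Prod>k\<in>I - c ` {..<t}. card S)"
      by (intro prod.cong) auto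
    also have "\<dots> = card S ^ (card I - t)"
      using assms(1-3) by (simp add: card_Diff_subset card_image)
    finally show ?thesis .
  qed
  have fin: "finite (E x)" for x
    unfolding E_def using assms(1,5) by (intro finite_subset[OF _ finite_PiE[of I "\<lambda>_. S"]]) auto
  have "finite M" using M assms(5) by (meson finite_PiE finite_lessThan finite_subset)
  have "{g \<in> I \<rightarrow>\<^sub>E S. (\<lambda>i\<in>{..<t}. g (c i)) \<in> M} = (\<Union>x\<in>M. E x)"
    unfolding E_def by auto
  also have "card \<dots> = (\<Sum>x\<in>M. card (E x))"
    using \<open>finite M\<close> fin by (intro card_UN_disjoint) (auto simp: E_def)
  finally show ?thesis using E by simp
qed

text \<open>The first moment method as double counting of the bad pairs.\<close>

lemma ex_card_le_average:
  fixes Bad :: "'a \<Rightarrow> 'b \<Rightarrow> bool"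
  assumes "finite F" "F \<noteq> {}" "finite X"
    and "(\<Sum>x\<in>X. card {f \<in> F. Bad f x}) \<le> n * card F"
  shows "\<exists>f\<in>F. card {x \<in> X. Bad f x} \<le> n"
proof (rule ccontr)
  assume "\<not> ?thesis"
  then have less: "n < card {x \<in> X. Bad f x}" if "f \<in> F" for f using that by force
  have "n * card F = (\<Sum>f\<in>F. n)" by simp
  also have "\<dots> < (\<Sum>f\<in>F. card {x \<in> X. Bad f x})"
    using assms(1,2) less by (rule sum_strict_mono)
  also have "\<dots> = (\<Sum>x\<in>X. card {f \<in> F. Bad f x})"
    using assms(1,3) by (intro sum_multicount_gen) auto
  finally show False using assms(4) by simp
qed

text \<open>\<open>D\<close> is the inner array. Divided by \<open>s ^ t\<close>, the size of this
  set is the probability that one random block misses \<open>w\<close> in \<open>t\<close> given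
  columns.\<close>

definition missing_tuples ::
    "nat \<Rightarrow> nat \<Rightarrow> nat \<Rightarrow> (nat \<Rightarrow> nat \<Rightarrow> nat) \<Rightarrow> (nat \<Rightarrow> nat) \<Rightarrow> (nat \<Rightarrow> nat) set" where
  "missing_tuples t R s D w = {x \<in> {..<t} \<rightarrow>\<^sub>E {..<s}. \<forall>r<R. \<exists>i<t. D r (x i) \<noteq> w i}"

text \<open>In block \<open>b\<close>, \<open>f b\<close> gives each of the \<open>N\<close> columns
  a random inner symbol. The expected number of missed pairs is at most
  \<open>N ^ t * q ^ t * (B / s ^ t) ^ m\<close>; \<open>bound\<close> says, without denominators,
  that this is at most \<open>n\<close>.\<close>

lemma ex_few_uncovered:
  fixes D :: "nat \<Rightarrow> nat \<Rightarrow> nat"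
  assumes "s > 0" "t \<le> N" "W \<subseteq> {..<t} \<rightarrow>\<^sub>E {..<q}"
    and B: "\<And>w. w \<in> W \<Longrightarrow> card (missing_tuples t R s D w) \<le> B"
    and bound: "N ^ t * q ^ t * B ^ m \<le> n * (s ^ t) ^ m"
  defines "T \<equiv> {c \<in> {..<t} \<rightarrow>\<^sub>E {..<N}. inj_on c {..<t}}"
  shows "\<exists>f \<in> {..<m} \<rightarrow> ({..<N} \<rightarrow> {..<s}).
    card {(c, w) \<in> T \<times> W. \<forall>b<m. (\<lambda>i\<in>{..<t}. f b (c i)) \<in> missing_tuples t R s D w} \<le> n"
proof -
  define F where "F = {..<m} \<rightarrow>\<^sub>E ({..<N} \<rightarrow>\<^sub>E {..<s})"
  define Bad where
    "Bad f = (\<lambda>(c, w). \<forall>b<m. (\<lambda>i\<in>{..<t}. f b (c i)) \<in> missing_tuples t R s D w)"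
    for f :: "nat \<Rightarrow> nat \<Rightarrow> nat"
  have cardF: "card F = (s ^ N) ^ m" by (simp add: F_def card_PiE)
  have "finite F" by (auto simp: F_def intro!: finite_PiE)
  have "F \<noteq> {}" using \<open>s > 0\<close> cardF by auto
  have finW: "finite W"
    using assms(3) by (rule finite_subset) (simp add: finite_PiE)
  have "card W \<le> card ({..<t} \<rightarrow>\<^sub>E {..<q})"
    using assms(3) by (intro card_mono finite_PiE) auto
  then have cardW: "card W \<le> q ^ t" by (simp add: card_PiE)
  have T: "T \<subseteq> {..<t} \<rightarrow>\<^sub>E {..<N}" by (auto simp: T_def)
  then have finT: "finite T" by (rule finite_subset) (simp add: finite_PiE)
  have "card T \<le> card ({..<t} \<rightarrow>\<^sub>E {..<N})"
    using T by (intro card_mono finite_PiE) auto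
  then have cardT: "card T \<le> N ^ t" by (simp add: card_PiE)
  have one: "card {f \<in> F. Bad f (c, w)} \<le> (B * s ^ (N - t)) ^ m" if "c \<in> T" "w \<in> W" for c w
  proof -
    let ?G = "{g \<in> {..<N} \<rightarrow>\<^sub>E {..<s}. (\<lambda>i\<in>{..<t}. g (c i)) \<in> missing_tuples t R s D w}"
    \<comment> \<open>The blocks are chosen independently, so the bad choices form an
      \<open>m\<close>-fold product.\<close>
    have "{f \<in> F. Bad f (c, w)} = {..<m} \<rightarrow>\<^sub>E ?G"
      by (auto simp: F_def Bad_def PiE_iff extensional_def)
    then have "card {f \<in> F. Bad f (c, w)} = card ?G ^ m"
      by (simp add: card_PiE)
    also have "\<dots> = (card (missing_tuples t R s D w) * s ^ (N - t)) ^ m"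
    proof -
      have "inj_on c {..<t}" "c ` {..<t} \<subseteq> {..<N}" using that(1) by (auto simp: T_def)
      moreover have "missing_tuples t R s D w \<subseteq> {..<t} \<rightarrow>\<^sub>E {..<s}"
        by (simp add: missing_tuples_def)
      ultimately show ?thesis by (simp add: card_PiE_restrict_comp)
    qed
    also have "\<dots> \<le> (B * s ^ (N - t)) ^ m"
      using B[OF that(2)] by (intro power_mono) auto
    finally show ?thesis .
  qed
  have "(\<Sum>x\<in>T \<times> W. card {f \<in> F. Bad f x}) \<le> card (T \<times> W) * (B * s ^ (N - t)) ^ m"
    using one sum_bounded_above[of "T \<times> W" "\<lambda>x. card {f \<in> F. Bad f x}" "(B * s ^ (N - t)) ^ m"]
    by auto
  also have "\<dots> \<le> (N ^ t * q ^ t) * (B * s ^ (N - t)) ^ m"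
    unfolding card_cartesian_product by (intro mult_le_mono cardW cardT order_refl)
  also have "\<dots> = (N ^ t * q ^ t * B ^ m) * (s ^ (N - t)) ^ m"
    by (simp add: power_mult_distrib)
  also have "\<dots> \<le> (n * (s ^ t) ^ m) * (s ^ (N - t)) ^ m"
    using bound by (rule mult_le_mono1)
  also have "\<dots> = n * (s ^ t * s ^ (N - t)) ^ m"
    by (simp only: power_mult_distrib mult.assoc)
  also have "s ^ t * s ^ (N - t) = s ^ N"
    using \<open>t \<le> N\<close> by (simp flip: power_add)
  finally have "(\<Sum>x\<in>T \<times> W. card {f \<in> F. Bad f x}) \<le> n * card F"
    unfolding cardF .
  then have "\<exists>f\<in>F. card {x \<in> T \<times> W. Bad f x} \<le> n"
    by (intro ex_card_le_average \<open>finite F\<close> \<open>F \<noteq> {}\<close> finite_cartesian_product finT finW)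
  then obtain f where f: "f \<in> F" "card {x \<in> T \<times> W. Bad f x} \<le> n"
    by (rule bexE)
  have "f \<in> {..<m} \<rightarrow> ({..<N} \<rightarrow> {..<s})" using f(1) by (simp add: F_def PiE_def Pi_def)
  moreover have "{x \<in> T \<times> W. Bad f x} = {(c, w) \<in> T \<times> W.
      \<forall>b<m. (\<lambda>i\<in>{..<t}. f b (c i)) \<in> missing_tuples t R s D w}"
    by (auto simp: Bad_def)
  ultimately show ?thesis using f(2) by (intro bexI[of _ f]) simp_all
qed

text \<open>Deletion method: among \<open>2 * n\<close> random columns at most \<open>n\<close>
  pairs are missed, and dropping one column for each leaves at least \<open>n\<close>. The
  \<open>q\<close> extra rows are constant.\<close>

lemma covering_array_number_concat_le:
  fixes D :: "nat \<Rightarrow> nat \<Rightarrow> nat"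
  assumes "s > 0" "t > 0" "t \<le> 2 * n"
    and D: "\<And>r x. r < R \<Longrightarrow> x < s \<Longrightarrow> D r x < q"
    and B: "\<And>w. w \<in> {..<t} \<rightarrow> {..<q} \<Longrightarrow> \<nexists>a. \<forall>i<t. w i = a \<Longrightarrow>
              card (missing_tuples t R s D w) \<le> B"
    and bound: "(2 * n) ^ t * q ^ t * B ^ m \<le> n * (s ^ t) ^ m"
  shows "covering_array_number t q n \<le> R * m + q"
proof -
  define W where "W = {w \<in> {..<t} \<rightarrow>\<^sub>E {..<q}. \<nexists>a. \<forall>i<t. w i = a}"
  define T where "T = {c \<in> {..<t} \<rightarrow>\<^sub>E {..<2 * n}. inj_on c {..<t}}"
  have W: "W \<subseteq> {..<t} \<rightarrow>\<^sub>E {..<q}" by (auto simp: W_def)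
  have "card (missing_tuples t R s D w) \<le> B" if "w \<in> W" for w
    using that B[of w] by (auto simp: W_def PiE_iff)
  from ex_few_uncovered[OF assms(1,3) W this bound]
  obtain f where f: "f \<in> {..<m} \<rightarrow> ({..<2 * n} \<rightarrow> {..<s})"
    and fcard: "card {(c, w) \<in> T \<times> W. \<forall>b<m.
      (\<lambda>i\<in>{..<t}. f b (c i)) \<in> missing_tuples t R s D w} \<le> n" (is "card ?U \<le> n")
    unfolding T_def by (rule bexE)
  have "finite T" "finite W"
    unfolding T_def W_def by (simp_all add: finite_PiE)
  then have finU: "finite ?U" by (intro finite_subset[of ?U "T \<times> W"]) auto
  \<comment> \<open>The deleted columns: the first column of every missed pair. The injection
    \<open>h\<close> below selects \<open>n\<close> of the others.\<close>
  define Z where "Z = (\<lambda>(c, w). c 0) ` ?U"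
  have "card Z \<le> n" "finite Z"
    using card_image_le[OF finU] fcard finU by (auto simp: Z_def intro: le_trans)
  then have "n \<le> card ({..<2 * n} - Z)"
    using diff_card_le_card_Diff[of Z "{..<2 * n}"] by simp
  then obtain h where h: "h ` {..<n} \<subseteq> {..<2 * n} - Z" "inj_on h {..<n}"
    using card_le_inj[of "{..<n}" "{..<2 * n} - Z"] by auto
  \<comment> \<open>Row \<open>R * b + r\<close> is row \<open>r\<close> of block \<open>b\<close>;
    the last \<open>q\<close> rows are the constant ones.\<close>
  define A where
    "A r j = (if r < R * m then D (r mod R) (f (r div R) (h j)) else r - R * m)" for r j
  have fh: "f b (h j) < s" if "b < m" "j < n" for b j
  proof -
    have "h j \<in> {..<2 * n}" using h(1) that(2) by blast
    moreover have "f b \<in> {..<2 * n} \<rightarrow> {..<s}" using f that(1) by (simp add: Pi_iff)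
    ultimately show ?thesis by (simp add: Pi_iff)
  qed
  have "A r j < q" if "r < R * m + q" "j < n" for r j
  proof (cases "r < R * m")
    case True
    then have "R > 0" by (cases R) auto
    then show ?thesis
      using True D[of "r mod R"] fh[OF _ that(2)]
      by (simp add: A_def less_mult_imp_div_less mult.commute)
  next
    case False
    then show ?thesis using that by (simp add: A_def)
  qed
  moreover have "\<exists>r<R * m + q. \<forall>i<t. A r (c i) = w i"
    if c: "c \<in> {..<t} \<rightarrow> {..<n}" "inj_on c {..<t}" and w: "w \<in> {..<t} \<rightarrow> {..<q}" for c w
  proof (cases "\<exists>a. \<forall>i<t. w i = a")
    case True
    then obtain a where a: "\<forall>i<t. w i = a" by blast
    then have "a < q" using w \<open>t > 0\<close> by (auto simp: Pi_iff)
    then show ?thesis using a by (intro exI[of _ "R * m + a"]) (simp add: A_def)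
  next
    case False
    define c' where "c' = (\<lambda>i\<in>{..<t}. h (c i))"
    define w' where "w' = restrict w {..<t}"
    have hc: "h (c i) \<in> {..<2 * n} - Z" if "i < t" for i
      using h(1) c(1) that by (auto simp: Pi_iff)
    have "inj_on c' {..<t}"
      using c h(2) by (auto simp: c'_def inj_on_def Pi_iff)
    then have "c' \<in> T" using hc by (auto simp: T_def c'_def)
    moreover have "w' \<in> W" using w False by (auto simp: W_def w'_def)
    moreover have "(c', w') \<notin> ?U"
    proof
      assume "(c', w') \<in> ?U"
      then have "c' 0 \<in> Z" by (force simp: Z_def)
      then show False using hc[OF \<open>t > 0\<close>] \<open>t > 0\<close> by (simp add: c'_def)
    qed
    ultimately obtain b where b: "b < m"
      "(\<lambda>i\<in>{..<t}. f b (c' i)) \<notin> missing_tuples t R s D w'" by blast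
    have "(\<lambda>i\<in>{..<t}. f b (c' i)) \<in> {..<t} \<rightarrow>\<^sub>E {..<s}"
      using fh[OF b(1)] c(1) by (auto simp: c'_def Pi_iff)
    then obtain r where r: "r < R" "\<forall>i<t. D r (f b (h (c i))) = w i"
      using b(2) by (auto simp: missing_tuples_def c'_def w'_def)
    have "R * b + r < R * m"
    proof -
      have "R * b + r < R * Suc b" using r(1) by simp
      also have "\<dots> \<le> R * m" using b(1) by (intro mult_le_mono2) simp
      finally show ?thesis .
    qed
    then show ?thesis
      using r by (intro exI[of _ "R * b + r"]) (auto simp: A_def)
  qed
  ultimately have "covering_array t q (R * m + q) n A"
    unfolding covering_array_def by blast
  then show ?thesis
    unfolding covering_array_number_def by (intro Least_le) blast
qed

section \<open>The tetracode\<close>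

text \<open>The codeword with message \<open>(x div 3, x mod 3)\<close>.\<close>

definition tetracode :: "nat \<Rightarrow> nat \<Rightarrow> nat" where
  "tetracode p x = [x div 3, x mod 3, (x div 3 + x mod 3) mod 3, (x div 3 + 2 * (x mod 3)) mod 3] ! p"

text \<open>
  The six permutations of the alphabet are the maps \<open>a \<mapsto> u a + v\<close> with \<open>u \<in> {1, 2}\<close>. Row
  \<open>6 p + 2 v + (u - 1)\<close> is the image of position \<open>p\<close>.
\<close>

definition tetracode_orbit :: "nat \<Rightarrow> nat \<Rightarrow> nat" where
  "tetracode_orbit r x = (Suc (r mod 2) * tetracode (r div 6) x + r div 2 mod 3) mod 3"

text \<open>For a ternary alphabet this is a complete invariant of triples under permutation of the
  symbols.\<close>

definition eq_pattern :: "'a \<Rightarrow> 'a \<Rightarrow> 'a \<Rightarrow> bool \<times> bool \<times> bool" where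
  "eq_pattern a b c = (a = b, a = c, b = c)"

text \<open>A list instead of a set, so that its length can be computed by evaluation.\<close>

definition tetracode_missing :: "bool \<times> bool \<times> bool \<Rightarrow> (nat \<times> nat \<times> nat) list" where
  "tetracode_missing \<pi> = filter (\<lambda>(x, y, z).
     \<forall>p\<in>set [0..<4]. eq_pattern (tetracode p x) (tetracode p y) (tetracode p z) \<noteq> \<pi>)
     (List.product [0..<9] (List.product [0..<9] [0..<9]))"

text \<open>Distinct codewords agree in exactly one position. So \<open>aab\<close> is missed if all
  three words coincide (9 triples), or if the first two differ and the third agrees with them where
  they agree (72 * 3 triples); \<open>aba\<close> and \<open>baa\<close> are symmetric.
  \<open>abc\<close> is missed exactly when two words coincide: 9 + 3 * 72 triples.\<close>

lemma length_tetracode_missing: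
  "\<forall>\<pi>\<in>set [(True, False, False), (False, True, False), (False, False, True), (False, False, False)].
     length (tetracode_missing \<pi>) = 225"
  by code_simp

text \<open>The six affine maps are all permutations of the alphabet, and these act transitively on
  the triples of a given pattern.\<close>

lemma affine_transitive:
  fixes a b c a' b' c' :: nat
  assumes lt: "a < 3" "b < 3" "c < 3" "a' < 3" "b' < 3" "c' < 3"
    and eq: "eq_pattern a b c = eq_pattern a' b' c'"
  shows "\<exists>u\<in>{1,2}. \<exists>v\<in>{0,1,2}.
    (u * a + v) mod 3 = a' \<and> (u * b + v) mod 3 = b' \<and> (u * c + v) mod 3 = c'"
proof -
  have all: "\<forall>a\<in>{0,1,2::nat}. \<forall>b\<in>{0,1,2}. \<forall>c\<in>{0,1,2}. \<forall>a'\<in>{0,1,2}. \<forall>b'\<in>{0,1,2}. \<forall>c'\<in>{0,1,2}.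
      (a = b \<longleftrightarrow> a' = b') \<longrightarrow> (a = c \<longleftrightarrow> a' = c') \<longrightarrow> (b = c \<longleftrightarrow> b' = c') \<longrightarrow>
      (\<exists>u\<in>{1,2}. \<exists>v\<in>{0,1,2}.
        (u * a + v) mod 3 = a' \<and> (u * b + v) mod 3 = b' \<and> (u * c + v) mod 3 = c')"
    by simp
  have mem: "x \<in> {0, 1, 2}" if "x < 3" for x :: nat
    using that by auto
  have "a = b \<longleftrightarrow> a' = b'" "a = c \<longleftrightarrow> a' = c'" "b = c \<longleftrightarrow> b' = c'"
    using eq by (simp_all add: eq_pattern_def)
  then show ?thesis
    using all[THEN bspec, OF mem[OF lt(1)], THEN bspec, OF mem[OF lt(2)],
        THEN bspec, OF mem[OF lt(3)], THEN bspec, OF mem[OF lt(4)],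
        THEN bspec, OF mem[OF lt(5)], THEN bspec, OF mem[OF lt(6)]]
    by iprover
qed

text \<open>If some position showed the pattern of \<open>w\<close>, one of its six images would be
  \<open>w\<close> itself. Hence a missing tuple avoids this pattern in all four positions.\<close>

lemma card_missing_tetracode_orbit:
  assumes w: "w \<in> {..<3} \<rightarrow> {..<3}" and nonconst: "\<nexists>a. \<forall>i<3. w i = a"
  shows "card (missing_tuples 3 24 9 tetracode_orbit w) \<le> 225"
proof -
  define \<pi> where "\<pi> = eq_pattern (w 0) (w 1) (w 2)"
  have all3: "(\<forall>i<3. P i) \<longleftrightarrow> P 0 \<and> P 1 \<and> P 2" for P :: "nat \<Rightarrow> bool"
    by (auto simp: numeral_3_eq_3 less_Suc_eq numeral_2_eq_2)
  have w3: "w 0 < 3" "w 1 < 3" "w 2 < 3" using w by (auto simp: Pi_iff)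
  \<comment> \<open>Two equalities force the third, so only four patterns remain.\<close>
  have "\<not> (w 0 = w 1 \<and> w 1 = w 2)" using nonconst unfolding all3 by metis
  then have "\<pi> \<in> set [(True, False, False), (False, True, False), (False, False, True),
      (False, False, False)]"
    unfolding \<pi>_def eq_pattern_def by auto
  then have len: "length (tetracode_missing \<pi>) = 225"
    using length_tetracode_missing by blast
  let ?M = "missing_tuples 3 24 9 tetracode_orbit w"
  let ?g = "\<lambda>x :: nat \<Rightarrow> nat. (x 0, x 1, x 2)"
  have "inj_on ?g ?M"
  proof (rule inj_onI)
    fix x y assume "x \<in> ?M" "y \<in> ?M" and g: "?g x = ?g y"
    then have "x \<in> {..<3} \<rightarrow>\<^sub>E {..<9}" "y \<in> {..<3} \<rightarrow>\<^sub>E {..<9}" by (auto simp: missing_tuples_def)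
    moreover have "\<forall>i<3. x i = y i" using g unfolding all3 by simp
    ultimately show "x = y" by (intro PiE_ext) auto
  qed
  moreover have "?g ` ?M \<subseteq> set (tetracode_missing \<pi>)"
  proof (rule image_subsetI)
    fix x assume x: "x \<in> ?M"
    then have x9: "x 0 < 9" "x 1 < 9" "x 2 < 9" by (auto simp: missing_tuples_def PiE_iff)
    have "eq_pattern (tetracode p (x 0)) (tetracode p (x 1)) (tetracode p (x 2)) \<noteq> \<pi>"
      if p: "p < 4" for p
    proof
      assume eq: "eq_pattern (tetracode p (x 0)) (tetracode p (x 1)) (tetracode p (x 2)) = \<pi>"
      have p4: "p = 0 \<or> p = 1 \<or> p = 2 \<or> p = 3" using p by auto
      have t3: "tetracode p y < 3" if "y < 9" for y
      proof -
        have "y div 3 < 3" using that by simp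
        then show ?thesis using p4 by (auto simp: tetracode_def)
      qed
      obtain u v where uv: "u \<in> {1,2}" "v \<in> {0,1,2}"
        "(u * tetracode p (x 0) + v) mod 3 = w 0" "(u * tetracode p (x 1) + v) mod 3 = w 1"
        "(u * tetracode p (x 2) + v) mod 3 = w 2"
        using affine_transitive[OF t3[OF x9(1)] t3[OF x9(2)] t3[OF x9(3)] w3] eq
        unfolding \<pi>_def by blast
      \<comment> \<open>The row holding the image of position \<open>p\<close> under the map given
        by \<open>u\<close> and \<open>v\<close>; \<open>u - 1\<close> is not truncated, as
        \<open>u\<close> is 1 or 2.\<close>
      define r where "r = 6 * p + 2 * v + (u - 1)"
      have "Suc (r mod 2) = u" "r div 6 = p" "r div 2 mod 3 = v" and r: "r < 24"
        using p4 uv(1,2) by (auto simp: r_def)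
      then have "\<forall>i<3. tetracode_orbit r (x i) = w i"
        unfolding all3 tetracode_orbit_def using uv(3-5) by simp
      then show False using x r by (auto simp: missing_tuples_def)
    qed
    then show "?g x \<in> set (tetracode_missing \<pi>)"
      using x9 by (simp add: tetracode_missing_def)
  qed
  ultimately have "card ?M \<le> card (set (tetracode_missing \<pi>))"
    by (intro card_inj_on_le) auto
  also have "\<dots> \<le> 225" using card_length[of "tetracode_missing \<pi>"] len by simp
  finally show ?thesis .
qed

section \<open>The number of blocks and the asymptotic bound\<close>

lemma covering_array_number_3_3_le:
  assumes "n \<ge> 2" "216 * n ^ 2 * 225 ^ m \<le> (729::nat) ^ m"
  shows "covering_array_number 3 3 n \<le> 24 * m + 3"
proof (rule covering_array_number_concat_le)
  show "tetracode_orbit r x < 3" for r x by (simp add: tetracode_orbit_def)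
  \<comment> \<open>Here 216 = 2^3 * 3^3 and 729 = 9^3; one factor \<open>n\<close> cancels against
    the \<open>n\<close> pairs that may be missed.\<close>
  have "(2 * n) ^ 3 * 3 ^ 3 * 225 ^ m = n * (216 * n ^ 2 * 225 ^ m)"
    by (simp add: power_mult_distrib power2_eq_square power3_eq_cube)
  also have "\<dots> \<le> n * 729 ^ m" using assms(2) by simp
  finally show "(2 * n) ^ 3 * 3 ^ 3 * 225 ^ m \<le> n * (9 ^ 3) ^ m" by simp
qed (use assms(1) card_missing_tetracode_orbit in auto)

text \<open>As 216 \<le> 2^8, a gain of \<open>8 + 2 * L\<close> bits suffices, and each block gains
  at least 3/2 bits. The slope is 24 * 2 * (2/3) = 32.\<close>

lemma covering_array_number_3_3_le_log:
  assumes "n \<ge> 2"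
  shows "real (covering_array_number 3 3 n) \<le> 32 * log 2 (real n) + 155"
proof -
  define L where "L = log 2 (real n)"
  define m where "m = nat \<lceil>(8 + 2 * L) * (2 / 3)\<rceil>"
  have "L \<ge> 0" using assms by (simp add: L_def)
  then have m: "(8 + 2 * L) * (2 / 3) \<le> real m" "real m \<le> (8 + 2 * L) * (2 / 3) + 1"
    by (simp_all add: m_def)
  have n: "2 powr L = real n" using assms by (simp add: L_def)
  have "(2 powr (3 / 2)) ^ 2 = (8::real)" by (simp flip: powr_powr_swap powr_realpow add: powr_powr)
  also have "\<dots> \<le> (81 / 25) ^ 2" by (simp add: power2_eq_square)
  finally have base: "2 powr (3 / 2) \<le> (81 / 25 :: real)" by (rule power2_le_imp_le) simp
  have "216 * real n ^ 2 \<le> 2 powr 8 * (2 powr L) ^ 2" by (simp add: n)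
  also have "\<dots> = 2 powr (8 + 2 * L)"
    by (simp only: powr_add power2_eq_square mult_2)
  also have "\<dots> \<le> 2 powr (3 / 2 * real m)" using m(1) by (intro powr_mono) auto
  also have "\<dots> = (2 powr (3 / 2)) ^ m" by (simp add: powr_powr flip: powr_realpow)
  also have "\<dots> \<le> (81 / 25) ^ m" using base by (intro power_mono) auto
  finally have "216 * real n ^ 2 * 225 ^ m \<le> (81 / 25) ^ m * 225 ^ m" by simp
  also have "\<dots> = 729 ^ m" by (simp flip: power_mult_distrib)
  finally have "real (216 * n ^ 2 * 225 ^ m) \<le> real (729 ^ m)" by simp
  then have "216 * n ^ 2 * 225 ^ m \<le> (729::nat) ^ m" by (simp only: of_nat_le_iff)
  from covering_array_number_3_3_le[OF assms this]
  have "real (covering_array_number 3 3 n) \<le> real (24 * m + 3)" by (simp only: of_nat_le_iff)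
  \<comment> \<open>155 = 24 * (16/3 + 1) + 3, where the 1 comes from rounding up.\<close>
  moreover have "real (24 * m + 3) \<le> 32 * L + 155" using m(2) by (simp add: field_simps)
  ultimately show ?thesis by (simp only: L_def order_trans)
qed

theorem theorem1:
  shows "\<exists>\<epsilon> \<in> o(\<lambda>_::nat. 1 :: real).
           \<forall>\<^sub>F n in sequentially.
             real (covering_array_number 3 3 n) \<le> 32.03 * log 2 (real n) * (1 + \<epsilon> n)"
proof (rule bexI[of _ "\<lambda>_. 0"])
  \<comment> \<open>From here on the slack of 0.03 in the slope absorbs the constant 155, so the
    error term can be zero.\<close>
  let ?C = "155 / 0.03 :: real"
  have "?C \<le> log 2 (real n)" if "n \<ge> nat \<lceil>2 powr ?C\<rceil>" "n \<ge> 2" for n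
  proof -
    have "2 powr ?C \<le> real n" using that(1) by linarith
    then show ?thesis using that(2) by (subst le_log_iff) auto
  qed
  then have "\<forall>\<^sub>F n in sequentially. ?C \<le> log 2 (real n)"
    by (intro eventually_sequentiallyI[of "max 2 (nat \<lceil>2 powr ?C\<rceil>)"]) simp
  then show "\<forall>\<^sub>F n in sequentially.
      real (covering_array_number 3 3 n) \<le> 32.03 * log 2 (real n) * (1 + 0)"
    using eventually_ge_at_top[of 2]
  proof eventually_elim
    case (elim n)
    then show ?case using covering_array_number_3_3_le_log[of n] by simp
  qed
qed simp

end
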